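(* Let $(X_N)_{N\in\mathbb{N}}$ be a sequence of centered real random variables with $\mathbb{E}[e^{hX_N}]<\infty$ for all $h\ge0$, let $M_N\in(0,+\infty]$ be the essential supremum of $X_N$, and let $0<a_N<M_N$. For $h\geq 0$ let $X_{N,h}$ be a random variable with the tilted law $$\mathbb{P}_{N,h}[dx]=\frac{e^{hx}}{\mathbb{E}[e^{hX_N}]}\,\mathbb{P}_N[dx],$$ where $\mathbb{P}_N$ is the law of $X_N$. There is a unique $h_N>0$ such that $\mathbb{E}[X_{N,h_N}]=a_N$; set $v_N=\mathrm{var}(X_{N,h_N})$. Let $(\varepsilon_N)$ be a sequence of positive numbers such that $$d_{\mathrm{Kol}}\left(\frac{X_{N,h_N}-a_N}{\sqrt{v_N}},\,\mathcal{N}_{\mathbb{R}}(0,1)\right)\lesssim\varepsilon_N .$$ (i) If $\varepsilon_N\ll\frac{1}{h_N\sqrt{v_N}}\ll1$, then $$\mathbb{P}[X_N\ge a_N]=\frac{\mathbb{E}[e^{h_N(X_N-a_N)}]}{h_N\sqrt{2\pi v_N}}\,(1+o(1)).$$ (ii) If $\varepsilon_N\lesssim\frac{1}{h_N\sqrt{v_N}}\ll1$, then $$\mathbb{P}[X_N\ge a_N]\lesssim\frac{\mathbb{E}[e^{h_N(X_N-a_N)}]}{h_N\sqrt{2\pi v_N}}.$$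
   Context: For nonnegative sequences, $a_N\ll b_N$ means $a_N/b_N\to0$, and $a_N\lesssim b_N$ means $\limsup a_N/b_N<\infty$. $d_{\mathrm{Kol}}$ is the Kolmogorov distance, i.e. the supremum over $s\in\mathbb{R}$ of the absolute difference of the distribution functions at $s$. $\mathcal{N}_{\mathbb{R}}(0,1)$ is the standard Gaussian law. *)

theory Defs
  imports "HOL-Probability.Probability" "HOL-Probability.Essential_Supremum"
begin

text \<open>Asymptotic comparison of nonnegative sequences. Division by zero is total in HOL, so these
  are only meaningful when \<open>b\<close> is eventually positive. The limsup is taken in the extended reals,
  where being finite is not automatic.\<close>

definition seq_negligible :: "(nat \<Rightarrow> real) \<Rightarrow> (nat \<Rightarrow> real) \<Rightarrow> bool"  (infix "\<lless>" 50)
  where "a \<lless> b \<longleftrightarrow> (\<lambda>N. a N / b N) \<longlonglongrightarrow> 0"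

definition seq_dominated :: "(nat \<Rightarrow> real) \<Rightarrow> (nat \<Rightarrow> real) \<Rightarrow> bool"  (infix "\<lessapprox>" 50)
  where "a \<lessapprox> b \<longleftrightarrow> limsup (\<lambda>N. ereal (a N / b N)) < \<infinity>"

definition kolmogorov_dist :: "real measure \<Rightarrow> real measure \<Rightarrow> real"
  where "kolmogorov_dist \<mu> \<nu> = (SUP s. \<bar>cdf \<mu> s - cdf \<nu> s\<bar>)"

definition tilted_law :: "'a measure \<Rightarrow> ('a \<Rightarrow> real) \<Rightarrow> real \<Rightarrow> real measure"
  where "tilted_law P X h =
    density (distr P borel X) (\<lambda>x. ennreal (exp (h * x) / (LINT \<omega>|P. exp (h * X \<omega>))))"

end

theory Submission
  imports Defs
begin

text \<open>
  The proof compares the tail probability with the same quantity for a Gaussian after exponential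
  tilting. Put \<open>Y = X - a\<close>. The tilted law of parameter \<open>h\<close> has mean \<open>a\<close> if and only if
  \<open>E[Y * exp (h * Y)] = 0\<close>. This expectation is continuous and strictly increasing in \<open>h\<close> and
  changes sign, which gives existence and uniqueness of \<open>h\<close> (lemma \<open>ex1_zero\<close>).

  Let \<open>\<mu>\<close> be the standardised tilted law, \<open>d\<close> its Kolmogorov distance to the standard Gaussian law
  and \<open>l = h * sqrt v\<close>. Undoing the tilt expresses \<open>P[X \<ge> a]\<close> as \<open>E[exp (h * Y)]\<close> times the
  Laplace transform at \<open>l\<close> of \<open>\<mu>\<close> restricted to the half line \<open>{0..}\<close> (lemma
  \<open>prob_ge_eq_laplace_half_line\<close>). Since \<open>exp (- l * t)\<close> is the probability that an exponential
  variable of rate \<open>l\<close> exceeds \<open>t\<close>, this transform is an average of the masses that \<open>\<mu>\<close> gives to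
  intervals, so replacing \<open>\<mu>\<close> by the Gaussian law costs at most \<open>2 * d\<close> (lemma
  \<open>laplace_half_line_diff_le_kolmogorov_dist\<close>). The Gaussian transform, multiplied by
  \<open>l * sqrt (2 * pi)\<close>, lies between \<open>1 - 1 / l\<^sup>2\<close> and \<open>1\<close> (lemma
  \<open>laplace_half_line_std_normal\<close>).

  Hence the quotient of \<open>P[X \<ge> a]\<close> by its predicted value differs from \<open>1\<close> by at most
  \<open>1 / l\<^sup>2 + 2 * sqrt (2 * pi) * l * d\<close> (lemma \<open>prob_ge_ratio\<close>). The first term
  tends to \<open>0\<close>. As \<open>d\<close> is eventually at most a constant times \<open>\<epsilon>\<close>, the second term tends to \<open>0\<close> when \<open>\<epsilon>\<close> is negligible against \<open>1 / l\<close>, and stays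
  bounded when \<open>\<epsilon>\<close> is dominated by \<open>1 / l\<close>.
\<close>

section \<open>Kolmogorov distance and Laplace transforms on the half line\<close>

lemma abs_cdf_diff_le_kolmogorov_dist:
  assumes "real_distribution \<mu>" and "real_distribution \<nu>"
  shows "\<bar>cdf \<mu> s - cdf \<nu> s\<bar> \<le> kolmogorov_dist \<mu> \<nu>"
proof -
  interpret \<mu>: real_distribution \<mu> by fact
  interpret \<nu>: real_distribution \<nu> by fact
  have "\<bar>cdf \<mu> t - cdf \<nu> t\<bar> \<le> 1" for t
    using \<mu>.cdf_nonneg[of t] \<nu>.cdf_nonneg[of t] \<mu>.cdf_bounded_prob[of t] \<nu>.cdf_bounded_prob[of t]
    by linarith
  then have "bdd_above (range (\<lambda>t. \<bar>cdf \<mu> t - cdf \<nu> t\<bar>))"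
    by (intro bdd_aboveI2)
  then show ?thesis
    unfolding kolmogorov_dist_def by (rule cSUP_upper[OF UNIV_I])
qed

lemma kolmogorov_dist_nonneg:
  assumes "real_distribution \<mu>" and "real_distribution \<nu>"
  shows "0 \<le> kolmogorov_dist \<mu> \<nu>"
  using abs_cdf_diff_le_kolmogorov_dist[OF assms, of 0] by linarith

text \<open>The bound passes to open half lines, whose masses are left limits of distribution functions.\<close>

lemma abs_measure_lessThan_diff_le_kolmogorov_dist:
  assumes "real_distribution \<mu>" and "real_distribution \<nu>"
  shows "\<bar>measure \<mu> {..<s} - measure \<nu> {..<s}\<bar> \<le> kolmogorov_dist \<mu> \<nu>"
proof -
  interpret \<mu>: real_distribution \<mu> by fact
  interpret \<nu>: real_distribution \<nu> by fact
  have "((\<lambda>t. \<bar>cdf \<mu> t - cdf \<nu> t\<bar>) \<longlongrightarrow> \<bar>measure \<mu> {..<s} - measure \<nu> {..<s}\<bar>) (at_left s)"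
    by (intro tendsto_intros \<mu>.cdf_at_left \<nu>.cdf_at_left)
  then show ?thesis
    by (rule tendsto_upperbound)
       (auto intro!: always_eventually abs_cdf_diff_le_kolmogorov_dist assms)
qed

lemma abs_measure_atLeastLessThan_diff_le_kolmogorov_dist:
  assumes "real_distribution \<mu>" and "real_distribution \<nu>" and "r \<le> s"
  shows "\<bar>measure \<mu> {r..<s} - measure \<nu> {r..<s}\<bar> \<le> 2 * kolmogorov_dist \<mu> \<nu>"
proof -
  have *: "measure \<rho> {r..<s} = measure \<rho> {..<s} - measure \<rho> {..<r}" if "real_distribution \<rho>" for \<rho>
  proof -
    interpret \<rho>: real_distribution \<rho> by fact
    have "measure \<rho> ({..<s} - {..<r}) = measure \<rho> {..<s} - measure \<rho> {..<r}"
      using \<open>r \<le> s\<close> by (intro \<rho>.finite_measure_Diff) auto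
    then show ?thesis by simp
  qed
  show ?thesis
    using abs_measure_lessThan_diff_le_kolmogorov_dist[OF assms(1,2), of s]
      abs_measure_lessThan_diff_le_kolmogorov_dist[OF assms(1,2), of r]
    by (simp add: *[OF assms(1)] *[OF assms(2)])
qed

lemma distributed_exponential_density:
  "distributed (density lborel (exponential_density l)) lborel (\<lambda>x. x) (exponential_density l)"
  by (auto simp: distributed_def intro!: distr_id2)

text \<open>Fubini for a variable of law \<open>\<mu>\<close> and an independent exponential variable \<open>S\<close> of rate
  \<open>l\<close>: the number \<open>exp (- l * t)\<close> is the probability that \<open>S\<close> exceeds \<open>t\<close>.\<close>

lemma laplace_half_line_eq_exponential_average:
  assumes "real_distribution \<mu>" and l: "0 < l"
  shows "(LINT t|\<mu>. indicator {0..} t * exp (- l * t)) =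
    (LINT s|density lborel (exponential_density l). measure \<mu> {0..<s})"
proof -
  interpret \<mu>: real_distribution \<mu> by fact
  let ?E = "density lborel (exponential_density l)"
  interpret E: prob_space ?E by (rule prob_space_exponential_density[OF l])
  interpret pair_prob_space \<mu> ?E by unfold_locales
  have [measurable_cong]: "sets ?E = sets borel" by simp
  let ?A = "{z. 0 \<le> fst z \<and> fst z < snd z} :: (real \<times> real) set"
  have A: "?A \<in> sets (\<mu> \<Otimes>\<^sub>M ?E)"
  proof -
    have "{z \<in> space (\<mu> \<Otimes>\<^sub>M ?E). 0 \<le> fst z \<and> fst z < snd z} \<in> sets (\<mu> \<Otimes>\<^sub>M ?E)"
      by measurable
    then show ?thesis by (simp add: space_pair_measure)
  qed
  have int: "integrable (\<mu> \<Otimes>\<^sub>M ?E) (case_prod (\<lambda>t s. indicator ?A (t, s) :: real))"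
    using A by (intro integrable_const_bound[where B=1]) auto
  have "(LINT t|\<mu>. indicator {0..} t * exp (- l * t)) =
      (LINT t|\<mu>. (LINT s|?E. indicator ?A (t, s)))"
  proof (rule Bochner_Integration.integral_cong[OF refl])
    fix t :: real
    show "indicator {0..} t * exp (- l * t) = (LINT s|?E. indicator ?A (t, s))"
    proof (cases "0 \<le> t")
      case True
      have "(LINT s|?E. indicator ?A (t, s)) = (LINT s|?E. indicator {t<..} s :: real)"
        using True by (intro Bochner_Integration.integral_cong) (auto simp: indicator_def)
      also have "\<dots> = measure ?E {t<..}" by simp
      also have "\<dots> = exp (- t * l)"
        using E.exponential_distributedD_gt[OF distributed_exponential_density True l]
        by (simp add: greaterThan_def)
      finally show ?thesis using True by (simp add: mult.commute)
    qed simp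
  qed
  also have "\<dots> = (LINT s|?E. (LINT t|\<mu>. indicator ?A (t, s)))"
    by (rule Fubini_integral[OF int, symmetric])
  also have "\<dots> = (LINT s|?E. measure \<mu> {0..<s})"
  proof (rule Bochner_Integration.integral_cong[OF refl])
    fix s :: real
    have "(LINT t|\<mu>. indicator ?A (t, s)) = (LINT t|\<mu>. indicator {0..<s} t :: real)"
      by (intro Bochner_Integration.integral_cong) (auto simp: indicator_def)
    then show "(LINT t|\<mu>. indicator ?A (t, s)) = measure \<mu> {0..<s}" by simp
  qed
  finally show ?thesis .
qed

lemma laplace_half_line_diff_le_kolmogorov_dist:
  assumes \<mu>: "real_distribution \<mu>" and \<nu>: "real_distribution \<nu>" and l: "0 < l"
  shows "\<bar>(LINT t|\<mu>. indicator {0..} t * exp (- l * t)) -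
      (LINT t|\<nu>. indicator {0..} t * exp (- l * t))\<bar> \<le> 2 * kolmogorov_dist \<mu> \<nu>"
proof -
  let ?E = "density lborel (exponential_density l)"
  interpret E: prob_space ?E by (rule prob_space_exponential_density[OF l])
  have int: "integrable ?E (\<lambda>s. measure \<rho> {0..<s})" if "real_distribution \<rho>" for \<rho>
  proof -
    interpret \<rho>: real_distribution \<rho> by fact
    have "mono (\<lambda>s. measure \<rho> {0..<s})"
      by (intro monoI \<rho>.finite_measure_mono) auto
    then have "(\<lambda>s. measure \<rho> {0..<s}) \<in> borel_measurable ?E"
      using borel_measurable_mono by auto
    then show ?thesis
      by (intro E.integrable_const_bound[where B=1]) auto
  qed
  have bound: "\<bar>measure \<mu> {0..<s} - measure \<nu> {0..<s}\<bar> \<le> 2 * kolmogorov_dist \<mu> \<nu>" for s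
  proof (cases "0 \<le> s")
    case False
    then show ?thesis using kolmogorov_dist_nonneg[OF \<mu> \<nu>] by simp
  qed (rule abs_measure_atLeastLessThan_diff_le_kolmogorov_dist[OF \<mu> \<nu>])
  have "\<bar>LINT s|?E. measure \<mu> {0..<s} - measure \<nu> {0..<s}\<bar>
      \<le> (LINT s|?E. \<bar>measure \<mu> {0..<s} - measure \<nu> {0..<s}\<bar>)"
    by (rule integral_abs_bound)
  also have "\<dots> \<le> (LINT s|?E. 2 * kolmogorov_dist \<mu> \<nu>)"
    by (intro integral_mono integrable_abs Bochner_Integration.integrable_diff int \<mu> \<nu> bound) auto
  also have "\<dots> = 2 * kolmogorov_dist \<mu> \<nu>"
    using E.prob_space by simp
  finally show ?thesis
    unfolding laplace_half_line_eq_exponential_average[OF \<mu> l]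
      laplace_half_line_eq_exponential_average[OF \<nu> l]
    by (simp add: \<mu> \<nu> int)
qed

text \<open>The number \<open>G\<close> is the expectation of \<open>exp (- T\<^sup>2 / 2)\<close> for an
  exponential variable \<open>T\<close> of rate \<open>l\<close>, and \<open>1 - T\<^sup>2 / 2 \<le> exp (- T\<^sup>2 / 2) \<le> 1\<close>.\<close>

lemma laplace_half_line_std_normal:
  assumes l: "0 < l"
  defines "G \<equiv> l * sqrt (2 * pi) * (LINT t|std_normal_distribution. indicator {0..} t * exp (- l * t))"
  shows "1 - 1 / l\<^sup>2 \<le> G" and "G \<le> 1"
proof -
  let ?E = "density lborel (exponential_density l)"
  interpret E: prob_space ?E by (rule prob_space_exponential_density[OF l])
  have "(LINT t|std_normal_distribution. indicator {0..} t * exp (- l * t)) =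
      (LINT t|lborel. std_normal_density t * (indicator {0..} t * exp (- l * t)))"
    by (subst integral_density) auto
  also have "\<dots> = (LINT t|lborel. (exponential_density l t * exp (- t\<^sup>2 / 2)) / (l * sqrt (2 * pi)))"
    using l by (intro Bochner_Integration.integral_cong)
      (auto simp: std_normal_density_def exponential_density_def indicator_def mult_ac)
  also have "\<dots> = (LINT t|?E. exp (- t\<^sup>2 / 2)) / (l * sqrt (2 * pi))"
    by (subst integral_density) (auto simp: exponential_density_nonneg l)
  finally have G: "G = (LINT t|?E. exp (- t\<^sup>2 / 2))"
    unfolding G_def using l by simp
  have int: "integrable ?E (\<lambda>t. exp (- t\<^sup>2 / 2))"
    by (intro E.integrable_const_bound[where B=1]) auto
  have "G \<le> (LINT t|?E. 1)"
    unfolding G by (intro integral_mono int) auto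
  then show "G \<le> 1" using E.prob_space by simp
  have int2: "integrable ?E (\<lambda>t. t\<^sup>2)"
    using E.erlang_ith_moment_integrable[OF l distributed_exponential_density] by simp
  have "(LINT t|?E. t\<^sup>2) = 2 / l\<^sup>2"
    using E.erlang_ith_moment[OF l distributed_exponential_density, of 2] by simp
  then have "1 - 1 / l\<^sup>2 = (LINT t|?E. 1 - t\<^sup>2 / 2)"
    using E.prob_space int2 by simp
  also have "\<dots> \<le> G"
    unfolding G
  proof (intro integral_mono int)
    show "1 - t\<^sup>2 / 2 \<le> exp (- t\<^sup>2 / 2)" for t :: real
      using exp_ge_add_one_self[of "- t\<^sup>2 / 2"] by simp
  qed (use int2 in auto)
  finally show "1 - 1 / l\<^sup>2 \<le> G" .
qed

section \<open>Exponential tilting\<close>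

text \<open>An integrable random variable \<open>X\<close> with all exponential moments, and a level \<open>a\<close> above its
  mean that \<open>X\<close> exceeds with positive probability.\<close>

locale tiltable = prob_space M for M :: "'a measure" +
  fixes X :: "'a \<Rightarrow> real" and a :: real
  assumes X_meas [measurable]: "X \<in> borel_measurable M"
    and X_int: "integrable M X"
    and X_exp: "\<And>h. 0 \<le> h \<Longrightarrow> integrable M (\<lambda>\<omega>. exp (h * X \<omega>))"
    and mean_less: "(LINT \<omega>|M. X \<omega>) < a"
    and not_AE_le: "\<not> (AE \<omega> in M. X \<omega> \<le> a)"
begin

text \<open>The variable centred at the level \<open>a\<close>.\<close>

abbreviation "Y \<omega> \<equiv> X \<omega> - a"

lemma integrable_Y: "integrable M Y"
  using X_int by simp

lemma exp_Y: "exp (h * Y \<omega>) = exp (- h * a) * exp (h * X \<omega>)"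
  by (simp add: algebra_simps flip: exp_add)

lemma integrable_exp_Y: "0 \<le> h \<Longrightarrow> integrable M (\<lambda>\<omega>. exp (h * Y \<omega>))"
  unfolding exp_Y by (intro integrable_mult_right X_exp)

text \<open>A bound uniform in \<open>h \<le> H\<close>, which serves as dominating function.\<close>

lemma abs_mult_exp_le:
  fixes y h H :: real
  assumes "0 \<le> h" "h \<le> H"
  shows "\<bar>y * exp (h * y)\<bar> \<le> \<bar>y\<bar> + exp ((H + 1) * y)"
proof (cases "0 \<le> y")
  case True
  have "y \<le> exp y"
    using exp_ge_add_one_self[of y] by linarith
  then have "y * exp (h * y) \<le> exp y * exp (H * y)"
    using True assms by (intro mult_mono) (auto intro: mult_right_mono)
  then show ?thesis
    using True by (simp add: abs_mult algebra_simps flip: exp_add)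
next
  case False
  then have "exp (h * y) \<le> 1"
    using assms by (simp add: mult_nonneg_nonpos)
  then have "\<bar>y\<bar> * exp (h * y) \<le> \<bar>y\<bar>"
    using mult_left_le[of "exp (h * y)" "\<bar>y\<bar>"] by simp
  then show ?thesis
    by (simp add: abs_mult add_increasing2)
qed

lemma integrable_mult_exp:
  assumes "0 \<le> h"
  shows "integrable M (\<lambda>\<omega>. Y \<omega> * exp (h * Y \<omega>))"
proof (rule Bochner_Integration.integrable_bound)
  show "integrable M (\<lambda>\<omega>. \<bar>Y \<omega>\<bar> + exp ((h + 1) * Y \<omega>))"
    using assms by (intro Bochner_Integration.integrable_add integrable_abs integrable_Y integrable_exp_Y) simp
  show "AE \<omega> in M. norm (Y \<omega> * exp (h * Y \<omega>)) \<le> norm (\<bar>Y \<omega>\<bar> + exp ((h + 1) * Y \<omega>))"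
    using abs_mult_exp_le[OF assms order_refl] by (auto intro!: AE_I2 order_trans[OF _ abs_ge_self])
qed measurable

text \<open>The bound \<open>u\<^sup>2 \<le> 2 * exp u\<close> for \<open>u \<ge> 0\<close> is used with \<open>u = y\<close> on the right half line and with
  \<open>u = - h * y\<close> on the left one. The latter needs \<open>h > 0\<close>: nothing is assumed about the square
  integrability of \<open>X\<close> itself.\<close>

lemma integrable_square_mult_exp:
  assumes "0 < h"
  shows "integrable M (\<lambda>\<omega>. (Y \<omega>)\<^sup>2 * exp (h * Y \<omega>))"
proof (rule Bochner_Integration.integrable_bound)
  show "integrable M (\<lambda>\<omega>. 2 * exp ((h + 1) * Y \<omega>) + 2 / h\<^sup>2)"
    using assms by (intro Bochner_Integration.integrable_add integrable_mult_right integrable_exp_Y) auto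
  have "y\<^sup>2 * exp (h * y) \<le> 2 * exp ((h + 1) * y) + 2 / h\<^sup>2" for y :: real
  proof (cases "0 \<le> y")
    case True
    have "y\<^sup>2 \<le> 2 * exp y"
      using exp_lower_Taylor_quadratic[OF True] True by simp
    then have "y\<^sup>2 * exp (h * y) \<le> 2 * exp y * exp (h * y)"
      by (intro mult_right_mono) auto
    also have "\<dots> = 2 * exp ((h + 1) * y)"
      by (simp add: algebra_simps flip: exp_add)
    finally show ?thesis by (simp add: add_increasing2)
  next
    case False
    then have pos: "0 \<le> - (h * y)" using assms by (simp add: mult_nonneg_nonpos)
    have "(h * y)\<^sup>2 \<le> 2 * exp (- (h * y))"
      using exp_lower_Taylor_quadratic[OF pos] pos by simp
    then have "(h * y)\<^sup>2 * exp (h * y) \<le> 2 * exp (- (h * y)) * exp (h * y)"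
      by (intro mult_right_mono) auto
    also have "\<dots> = 2"
      by (simp flip: exp_add)
    finally have "y\<^sup>2 * exp (h * y) \<le> 2 / h\<^sup>2"
      using assms by (simp add: field_simps power_mult_distrib)
    then show ?thesis by (simp add: add_increasing)
  qed
  then show "AE \<omega> in M. norm ((Y \<omega>)\<^sup>2 * exp (h * Y \<omega>)) \<le> norm (2 * exp ((h + 1) * Y \<omega>) + 2 / h\<^sup>2)"
    by (auto intro!: AE_I2 order_trans[OF _ abs_ge_self])
qed measurable

text \<open>The function \<open>h \<mapsto> E[Y * exp (h * Y)]\<close> is continuous by dominated convergence, and strictly
  increasing because \<open>h \<mapsto> y * exp (h * y)\<close> is so for each \<open>y \<noteq> 0\<close>. It is negative at \<open>0\<close>, and it is at least
  \<open>h * E[(max Y 0)\<^sup>2] - E[\<bar>Y\<bar>]\<close>, which is nonnegative for large \<open>h\<close>.\<close>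

lemma ex1_zero:
  "\<exists>!h. 0 < h \<and> (LINT \<omega>|M. Y \<omega> * exp (h * Y \<omega>)) = 0"
proof -
  define g where "g h = (LINT \<omega>|M. Y \<omega> * exp (h * Y \<omega>))" for h
  have mono: "g h < g h'" if "0 \<le> h" "h < h'" for h h'
    unfolding g_def
  proof (rule integral_less_AE[where A="{\<omega> \<in> space M. a < X \<omega>}"])
    show "emeasure M {\<omega> \<in> space M. a < X \<omega>} \<noteq> 0"
      using not_AE_le by (subst (asm) AE_iff_measurable[OF _ refl]) (auto simp: not_le)
    show "AE \<omega> in M. \<omega> \<in> {\<omega> \<in> space M. a < X \<omega>} \<longrightarrow> Y \<omega> * exp (h * Y \<omega>) \<noteq> Y \<omega> * exp (h' * Y \<omega>)"
      using that by auto
    have "y * exp (h * y) \<le> y * exp (h' * y)" for y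
    proof (cases "0 \<le> y")
      case True
      then show ?thesis using that by (intro mult_left_mono) (auto intro: mult_right_mono)
    next
      case False
      then show ?thesis using that by (intro mult_left_mono_neg) (auto intro: mult_right_mono_neg)
    qed
    then show "AE \<omega> in M. Y \<omega> * exp (h * Y \<omega>) \<le> Y \<omega> * exp (h' * Y \<omega>)" by simp
  qed (use that in \<open>auto intro!: integrable_mult_exp\<close>)
  have g0: "g 0 < 0"
    using mean_less X_int prob_space by (simp add: g_def)
  have cont: "continuous_on {0..H} g" for H
    unfolding continuous_on_sequentially
  proof (intro allI impI ballI, elim conjE)
    fix x h assume x: "\<forall>n. x n \<in> {0..H}" and h: "h \<in> {0..H}" and lim: "x \<longlonglongrightarrow> h"
    have "(\<lambda>n. LINT \<omega>|M. Y \<omega> * exp (x n * Y \<omega>)) \<longlonglongrightarrow> (LINT \<omega>|M. Y \<omega> * exp (h * Y \<omega>))"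
    proof (rule integral_dominated_convergence)
      show "integrable M (\<lambda>\<omega>. \<bar>Y \<omega>\<bar> + exp ((H + 1) * Y \<omega>))"
        using h by (intro Bochner_Integration.integrable_add integrable_abs integrable_Y integrable_exp_Y) auto
      show "AE \<omega> in M. (\<lambda>n. Y \<omega> * exp (x n * Y \<omega>)) \<longlonglongrightarrow> Y \<omega> * exp (h * Y \<omega>)"
        by (intro AE_I2 tendsto_intros lim)
      show "AE \<omega> in M. norm (Y \<omega> * exp (x n * Y \<omega>)) \<le> \<bar>Y \<omega>\<bar> + exp ((H + 1) * Y \<omega>)" for n
        using abs_mult_exp_le[of "x n" H] x by auto
    qed measurable
    then show "(g \<circ> x) \<longlonglongrightarrow> g h" by (simp add: g_def comp_def)
  qed
  define p where "p = (LINT \<omega>|M. (max (Y \<omega>) 0)\<^sup>2)"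
  have p_int: "integrable M (\<lambda>\<omega>. (max (Y \<omega>) 0)\<^sup>2)"
  proof (rule Bochner_Integration.integrable_bound)
    show "integrable M (\<lambda>\<omega>. (Y \<omega>)\<^sup>2 * exp (1 * Y \<omega>))"
      by (rule integrable_square_mult_exp) simp
    have "(max y 0)\<^sup>2 \<le> y\<^sup>2 * exp (1 * y)" for y :: real
      using mult_left_mono[of 1 "exp y" "y\<^sup>2"] by (cases "0 \<le> y") auto
    then show "AE \<omega> in M. norm ((max (Y \<omega>) 0)\<^sup>2) \<le> norm ((Y \<omega>)\<^sup>2 * exp (1 * Y \<omega>))"
      by (auto intro!: AE_I2 order_trans[OF _ abs_ge_self])
  qed measurable
  have "p \<noteq> 0"
  proof
    assume "p = 0"
    then have "AE \<omega> in M. (max (Y \<omega>) 0)\<^sup>2 = 0"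
      using integral_nonneg_eq_0_iff_AE[OF p_int] by (simp add: p_def)
    then have "AE \<omega> in M. X \<omega> \<le> a"
      by eventually_elim (auto simp: max_def split: if_splits)
    then show False using not_AE_le by simp
  qed
  moreover have "0 \<le> p" by (simp add: p_def)
  ultimately have p: "0 < p" by simp
  define H where "H = (LINT \<omega>|M. \<bar>Y \<omega>\<bar>) / p"
  have H: "0 \<le> H" using p by (simp add: H_def)
  have lower: "H * (max y 0)\<^sup>2 - \<bar>y\<bar> \<le> y * exp (H * y)" for y :: real
  proof (cases "0 \<le> y")
    case True
    have "H * y\<^sup>2 = y * (H * y)" by (simp add: power2_eq_square)
    also have "\<dots> \<le> y * exp (H * y)"
      using True exp_ge_add_one_self[of "H * y"] by (intro mult_left_mono) linarith+
    finally show ?thesis using True by simp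
  next
    case False
    then have "exp (H * y) \<le> 1" using H by (simp add: mult_nonneg_nonpos)
    then show ?thesis
      using False mult_left_mono_neg[of "exp (H * y)" 1 y] by simp
  qed
  have "0 = H * p - (LINT \<omega>|M. \<bar>Y \<omega>\<bar>)" using p by (simp add: H_def)
  also have "\<dots> = (LINT \<omega>|M. H * (max (Y \<omega>) 0)\<^sup>2 - \<bar>Y \<omega>\<bar>)"
    using p_int integrable_Y by (simp add: p_def)
  also have "\<dots> \<le> g H"
    unfolding g_def
    by (intro integral_mono Bochner_Integration.integrable_diff integrable_mult_right p_int
        integrable_abs integrable_Y integrable_mult_exp H lower)
  finally have gH: "0 \<le> g H" .
  obtain h where h: "0 \<le> h" "g h = 0"
    using IVT'[of g 0 0 H] g0 gH H cont by (auto simp: less_imp_le)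
  moreover have "h \<noteq> 0" using h g0 by auto
  moreover have "h' = h" if "0 < h'" "g h' = 0" for h'
    using mono[of h h'] mono[of h' h] that h by (cases h h' rule: linorder_cases) auto
  ultimately show ?thesis
    unfolding g_def[symmetric] by (intro ex1I[of _ h]) auto
qed

lemma exp_mean_pos:
  assumes "0 \<le> h"
  shows "0 < (LINT \<omega>|M. exp (h * X \<omega>))"
proof -
  have "(LINT \<omega>|M. exp (h * X \<omega>)) \<noteq> 0"
    using integral_nonneg_eq_0_iff_AE[OF X_exp[OF assms]] by simp
  moreover have "0 \<le> (LINT \<omega>|M. exp (h * X \<omega>))" by (intro Bochner_Integration.integral_nonneg) auto
  ultimately show ?thesis by (auto simp: less_le)
qed

lemma integral_tilted_law:
  fixes f :: "real \<Rightarrow> real"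
  assumes "0 \<le> h" and [measurable]: "f \<in> borel_measurable borel"
  shows "(LINT x|tilted_law M X h. f x) =
    (LINT \<omega>|M. exp (h * X \<omega>) * f (X \<omega>)) / (LINT \<omega>|M. exp (h * X \<omega>))"
  unfolding tilted_law_def using exp_mean_pos[OF assms(1)]
  by (subst integral_density) (auto simp: integral_distr)

lemma real_distribution_tilted_law:
  assumes "0 \<le> h"
  shows "real_distribution (tilted_law M X h)"
proof -
  let ?Z = "LINT \<omega>|M. exp (h * X \<omega>)"
  have "emeasure (tilted_law M X h) (space (tilted_law M X h)) =
      (\<integral>\<^sup>+\<omega>. ennreal (exp (h * X \<omega>) / ?Z) \<partial>M)"
    unfolding tilted_law_def by (simp add: emeasure_density nn_integral_distr)
  also have "\<dots> = ennreal (LINT \<omega>|M. exp (h * X \<omega>) / ?Z)"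
    using X_exp[OF assms] exp_mean_pos[OF assms] by (intro nn_integral_eq_integral) auto
  also have "\<dots> = 1"
    using exp_mean_pos[OF assms] by simp
  finally have "prob_space (tilted_law M X h)" by (rule prob_spaceI)
  then show ?thesis
    by (auto simp: real_distribution_def real_distribution_axioms_def tilted_law_def)
qed

lemma mean_tilted_law_eq_iff:
  assumes "0 \<le> h"
  shows "(LINT x|tilted_law M X h. x) = a \<longleftrightarrow> (LINT \<omega>|M. Y \<omega> * exp (h * Y \<omega>)) = 0"
proof -
  let ?Z = "LINT \<omega>|M. exp (h * X \<omega>)"
  have int: "integrable M (\<lambda>\<omega>. exp (h * X \<omega>) * X \<omega>)"
  proof -
    have "integrable M (\<lambda>\<omega>. exp (h * a) * (Y \<omega> * exp (h * Y \<omega>)) + a * exp (h * X \<omega>))"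
      by (intro Bochner_Integration.integrable_add integrable_mult_right integrable_mult_exp X_exp assms)
    also have "(\<lambda>\<omega>. exp (h * a) * (Y \<omega> * exp (h * Y \<omega>)) + a * exp (h * X \<omega>)) =
        (\<lambda>\<omega>. exp (h * X \<omega>) * X \<omega>)"
      unfolding exp_Y by (auto simp: field_simps exp_minus)
    finally show ?thesis .
  qed
  have "(LINT \<omega>|M. Y \<omega> * exp (h * Y \<omega>)) =
      (LINT \<omega>|M. exp (- h * a) * (exp (h * X \<omega>) * X \<omega> - a * exp (h * X \<omega>)))"
    unfolding exp_Y by (intro Bochner_Integration.integral_cong) (simp_all add: algebra_simps del: mult_minus_left)
  also have "\<dots> = exp (- h * a) * ((LINT \<omega>|M. exp (h * X \<omega>) * X \<omega>) - a * ?Z)"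
    using int X_exp[OF assms] by simp
  finally have *: "(LINT \<omega>|M. Y \<omega> * exp (h * Y \<omega>)) =
    exp (- h * a) * ((LINT \<omega>|M. exp (h * X \<omega>) * X \<omega>) - a * ?Z)" .
  show ?thesis
    unfolding * using exp_mean_pos[OF assms]
    by (simp add: integral_tilted_law[OF assms] divide_eq_eq)
qed

lemma variance_tilted_law_pos:
  assumes "0 < h"
  shows "0 < (LINT x|tilted_law M X h. (x - a)\<^sup>2)"
proof -
  let ?S = "LINT \<omega>|M. (Y \<omega>)\<^sup>2 * exp (h * Y \<omega>)"
  have "?S \<noteq> 0"
  proof
    assume "?S = 0"
    then have "AE \<omega> in M. (Y \<omega>)\<^sup>2 * exp (h * Y \<omega>) = 0"
      using integral_nonneg_eq_0_iff_AE[OF integrable_square_mult_exp[OF assms]] by simp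
    then have "AE \<omega> in M. X \<omega> \<le> a" by eventually_elim auto
    then show False using not_AE_le by simp
  qed
  moreover have "0 \<le> ?S" by (intro Bochner_Integration.integral_nonneg) auto
  ultimately have "0 < exp (h * a) * ?S" by (auto simp: less_le)
  also have "exp (h * a) * ?S = (LINT \<omega>|M. exp (h * a) * ((Y \<omega>)\<^sup>2 * exp (h * Y \<omega>)))"
    by simp
  also have "\<dots> = (LINT \<omega>|M. exp (h * X \<omega>) * (Y \<omega>)\<^sup>2)"
    by (intro Bochner_Integration.integral_cong) (auto simp: exp_Y exp_minus)
  finally show ?thesis
    using exp_mean_pos[of h] assms by (simp add: integral_tilted_law)
qed

text \<open>The law of \<open>(X\<^sub>h - a) / sqrt v\<close> for a variable \<open>X\<^sub>h\<close> with the tilted law. The parameter \<open>v\<close>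
  may be any number here; it need not be the variance.\<close>

abbreviation "standardized_tilted_law h v \<equiv>
  distr (tilted_law M X h) borel (\<lambda>x. (x - a) / sqrt v)"

lemma real_distribution_standardized:
  assumes "0 \<le> h"
  shows "real_distribution (standardized_tilted_law h v)"
proof -
  interpret T: real_distribution "tilted_law M X h"
    by (rule real_distribution_tilted_law[OF assms])
  show ?thesis by (rule T.real_distribution_distr) measurable
qed

text \<open>Undoing the tilt: the density at \<open>x\<close> of the law of \<open>X\<close> with respect to the tilted law
  is \<open>E[exp (h * Y)] * exp (- h * (x - a))\<close>.\<close>

lemma prob_ge_eq_laplace_half_line:
  assumes h: "0 < h" and v: "0 < v"
  shows "\<P>(\<omega> in M. a \<le> X \<omega>) = (LINT \<omega>|M. exp (h * Y \<omega>)) *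
    (LINT t|standardized_tilted_law h v. indicator {0..} t * exp (- (h * sqrt v) * t))"
proof -
  interpret T: real_distribution "tilted_law M X h"
    using h by (intro real_distribution_tilted_law) simp
  let ?Z = "LINT \<omega>|M. exp (h * X \<omega>)"
  let ?f = "\<lambda>x. indicator {a..} x * exp (- h * (x - a)) :: real"
  have Z: "0 < ?Z" using h exp_mean_pos by simp
  have "(LINT t|standardized_tilted_law h v. indicator {0..} t * exp (- (h * sqrt v) * t)) =
      (LINT x|tilted_law M X h. ?f x)"
    using v by (subst integral_distr)
      (auto intro!: Bochner_Integration.integral_cong simp: indicator_def zero_le_divide_iff)
  also have "\<dots> = (LINT \<omega>|M. exp (h * X \<omega>) * ?f (X \<omega>)) / ?Z"
    using h by (subst integral_tilted_law) auto
  also have "(LINT \<omega>|M. exp (h * X \<omega>) * ?f (X \<omega>)) =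
      (LINT \<omega>|M. exp (h * a) * indicator {\<omega> \<in> space M. a \<le> X \<omega>} \<omega>)"
    by (intro Bochner_Integration.integral_cong)
      (auto simp: indicator_def algebra_simps simp flip: exp_add)
  also have "\<dots> = exp (h * a) * \<P>(\<omega> in M. a \<le> X \<omega>)"
    by simp
  finally show ?thesis
    using Z by (simp add: exp_Y exp_minus)
qed

text \<open>Here \<open>B\<close> is the predicted value of the probability of \<open>X \<ge> a\<close>.\<close>

lemma prob_ge_ratio:
  assumes h: "0 < h" and v: "0 < v"
  defines "l \<equiv> h * sqrt v"
  defines "B \<equiv> (LINT \<omega>|M. exp (h * Y \<omega>)) / (h * sqrt (2 * pi * v))"
  defines "d \<equiv> kolmogorov_dist (standardized_tilted_law h v) std_normal_distribution"
  shows "0 < B"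
    and "\<P>(\<omega> in M. a \<le> X \<omega>) / B \<le> 1 + 2 * sqrt (2 * pi) * (l * d)"
    and "\<bar>\<P>(\<omega> in M. a \<le> X \<omega>) / B - 1\<bar> \<le> 1 / l\<^sup>2 + 2 * sqrt (2 * pi) * (l * d)"
proof -
  have l: "0 < l" using h v by (simp add: l_def)
  have "0 < (LINT \<omega>|M. exp (h * Y \<omega>))"
    using exp_mean_pos[of h] h by (simp add: exp_Y)
  then show B: "0 < B" using h v by (simp add: B_def)
  define L where "L \<mu> = (LINT t|\<mu>. indicator {0..} t * exp (- l * t))" for \<mu> :: "real measure"
  let ?\<mu> = "standardized_tilted_law h v"
  have "\<P>(\<omega> in M. a \<le> X \<omega>) = (LINT \<omega>|M. exp (h * Y \<omega>)) * L ?\<mu>"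
    unfolding L_def l_def by (rule prob_ge_eq_laplace_half_line[OF h v])
  also have "(LINT \<omega>|M. exp (h * Y \<omega>)) = B * (l * sqrt (2 * pi))"
    using h v by (simp add: B_def l_def real_sqrt_mult)
  finally have R: "\<P>(\<omega> in M. a \<le> X \<omega>) / B = l * sqrt (2 * pi) * L ?\<mu>"
    using B by simp
  have "\<bar>L ?\<mu> - L std_normal_distribution\<bar> \<le> 2 * d"
    unfolding L_def d_def using h
    by (intro laplace_half_line_diff_le_kolmogorov_dist real_distribution_standardized
        real_dist_normal_dist l) simp
  then have "l * sqrt (2 * pi) * \<bar>L ?\<mu> - L std_normal_distribution\<bar> \<le> l * sqrt (2 * pi) * (2 * d)"
    using l by (intro mult_left_mono) auto
  moreover have "l * sqrt (2 * pi) * \<bar>L ?\<mu> - L std_normal_distribution\<bar> =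
      \<bar>l * sqrt (2 * pi) * L ?\<mu> - l * sqrt (2 * pi) * L std_normal_distribution\<bar>"
    using l by (simp add: abs_mult flip: right_diff_distrib)
  ultimately have diff: "\<bar>\<P>(\<omega> in M. a \<le> X \<omega>) / B - l * sqrt (2 * pi) * L std_normal_distribution\<bar>
      \<le> 2 * sqrt (2 * pi) * (l * d)"
    unfolding R by (simp add: mult_ac)
  note G = laplace_half_line_std_normal[OF l, folded L_def]
  show "\<P>(\<omega> in M. a \<le> X \<omega>) / B \<le> 1 + 2 * sqrt (2 * pi) * (l * d)"
    using diff G by linarith
  have "0 \<le> 1 / l\<^sup>2" by simp
  then show "\<bar>\<P>(\<omega> in M. a \<le> X \<omega>) / B - 1\<bar> \<le> 1 / l\<^sup>2 + 2 * sqrt (2 * pi) * (l * d)"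
    using diff G by linarith
qed

end

section \<open>Asymptotics\<close>

lemma seq_dominated_imp_eventually_le:
  assumes "u \<lessapprox> w"
  obtains C :: real where "0 \<le> C" "\<forall>\<^sub>F N in sequentially. u N / w N \<le> C"
proof -
  have "limsup (\<lambda>N. ereal (u N / w N)) \<noteq> \<infinity>"
    using assms by (simp add: seq_dominated_def)
  then obtain n :: nat where "limsup (\<lambda>N. ereal (u N / w N)) < ereal (real n)"
    by (auto simp: less_PInf_Ex_of_nat)
  then have "\<forall>\<^sub>F N in sequentially. ereal (u N / w N) < ereal (real n)"
    by (rule Limsup_lessD)
  then have "\<forall>\<^sub>F N in sequentially. u N / w N \<le> real n"
    by eventually_elim simp
  then show thesis by (rule that[rotated]) simp
qed

lemma eventually_le_imp_seq_dominated:
  assumes "\<forall>\<^sub>F N in sequentially. u N / w N \<le> (C :: real)"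
  shows "u \<lessapprox> w"
proof -
  have "limsup (\<lambda>N. ereal (u N / w N)) \<le> ereal C"
    using assms by (intro Limsup_bounded) simp
  then show ?thesis
    by (auto simp: seq_dominated_def)
qed

theorem mainTheorem3:
  fixes P :: "nat \<Rightarrow> 'a measure"
    and X :: "nat \<Rightarrow> 'a \<Rightarrow> real"
    and a :: "nat \<Rightarrow> real"
  assumes "\<And>N. prob_space (P N)"
    and "\<And>N. X N \<in> borel_measurable (P N)"
    and "\<And>N. integrable (P N) (X N)"
    and "\<And>N. (LINT \<omega>|P N. X N \<omega>) = 0"
    and "\<And>N h. h \<ge> 0 \<Longrightarrow> integrable (P N) (\<lambda>\<omega>. exp (h * X N \<omega>))"
    and "\<And>N. 0 < a N"
    and "\<And>N. ereal (a N) < esssup (P N) (\<lambda>\<omega>. ereal (X N \<omega>))"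
  shows "(\<forall>N. \<exists>!h. h > 0 \<and> prob_space.expectation (tilted_law (P N) (X N) h) (\<lambda>x. x) = a N) \<and>
    (\<forall>h v \<epsilon> :: nat \<Rightarrow> real.
      (\<forall>N. h N > 0 \<and> prob_space.expectation (tilted_law (P N) (X N) (h N)) (\<lambda>x. x) = a N) \<longrightarrow>
      (\<forall>N. v N = prob_space.variance (tilted_law (P N) (X N) (h N)) (\<lambda>x. x)) \<longrightarrow>
      (\<forall>N. \<epsilon> N > 0) \<longrightarrow>
      (\<lambda>N. kolmogorov_dist
             (distr (tilted_law (P N) (X N) (h N)) borel (\<lambda>x. (x - a N) / sqrt (v N)))
             std_normal_distribution) \<lessapprox> \<epsilon> \<longrightarrow>
      (\<epsilon> \<lless> (\<lambda>N. 1 / (h N * sqrt (v N))) \<and> (\<lambda>N. 1 / (h N * sqrt (v N))) \<lless> (\<lambda>N. 1) \<longrightarrow>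
        (\<exists>\<delta> :: nat \<Rightarrow> real. \<delta> \<longlonglongrightarrow> 0 \<and>
          (\<forall>N. \<P>(\<omega> in P N. X N \<omega> \<ge> a N) =
            (LINT \<omega>|P N. exp (h N * (X N \<omega> - a N))) / (h N * sqrt (2 * pi * v N)) * (1 + \<delta> N)))) \<and>
      (\<epsilon> \<lessapprox> (\<lambda>N. 1 / (h N * sqrt (v N))) \<and> (\<lambda>N. 1 / (h N * sqrt (v N))) \<lless> (\<lambda>N. 1) \<longrightarrow>
        (\<lambda>N. \<P>(\<omega> in P N. X N \<omega> \<ge> a N)) \<lessapprox>
        (\<lambda>N. (LINT \<omega>|P N. exp (h N * (X N \<omega> - a N))) / (h N * sqrt (2 * pi * v N)))))"
proof (intro conjI allI impI)
  have til: "tiltable (P N) (X N) (a N)" for N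
  proof -
    have "\<not> (AE \<omega> in P N. X N \<omega> \<le> a N)"
    proof
      assume "AE \<omega> in P N. X N \<omega> \<le> a N"
      then have "esssup (P N) (\<lambda>\<omega>. ereal (X N \<omega>)) \<le> ereal (a N)"
        using assms(2)[of N] by (intro esssup_I) auto
      then show False using assms(7)[of N] by simp
    qed
    then show ?thesis
      using assms by (simp add: tiltable_def tiltable_axioms_def)
  qed
  show "\<exists>!h. h > 0 \<and> prob_space.expectation (tilted_law (P N) (X N) h) (\<lambda>x. x) = a N" for N
  proof -
    interpret tiltable "P N" "X N" "a N" by (rule til)
    show ?thesis
      using ex1_zero by (simp add: mean_tilted_law_eq_iff cong: conj_cong)
  qed
  fix h v \<epsilon> :: "nat \<Rightarrow> real"
  assume h: "\<forall>N. h N > 0 \<and> prob_space.expectation (tilted_law (P N) (X N) (h N)) (\<lambda>x. x) = a N"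
    and v: "\<forall>N. v N = prob_space.variance (tilted_law (P N) (X N) (h N)) (\<lambda>x. x)"
    and \<epsilon>: "\<forall>N. \<epsilon> N > 0"
    and "(\<lambda>N. kolmogorov_dist
             (distr (tilted_law (P N) (X N) (h N)) borel (\<lambda>x. (x - a N) / sqrt (v N)))
             std_normal_distribution) \<lessapprox> \<epsilon>"
  define d where "d N = kolmogorov_dist
    (distr (tilted_law (P N) (X N) (h N)) borel (\<lambda>x. (x - a N) / sqrt (v N)))
    std_normal_distribution" for N
  have "d \<lessapprox> \<epsilon>"
    unfolding d_def by fact
  then obtain C where C: "0 \<le> C" "\<forall>\<^sub>F N in sequentially. d N / \<epsilon> N \<le> C"
    by (rule seq_dominated_imp_eventually_le)
  have hpos: "0 < h N" for N using h by simp
  have vpos: "0 < v N" for N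
    using tiltable.variance_tilted_law_pos[OF til hpos, of N] h v by simp
  define l where "l N = h N * sqrt (v N)" for N
  have lpos: "0 < l N" for N using hpos vpos by (simp add: l_def)
  define B where "B N = (LINT \<omega>|P N. exp (h N * (X N \<omega> - a N))) / (h N * sqrt (2 * pi * v N))" for N
  define R where "R N = \<P>(\<omega> in P N. X N \<omega> \<ge> a N) / B N" for N
  have Bpos: "0 < B N"
    and R_le: "R N \<le> 1 + 2 * sqrt (2 * pi) * (l N * d N)"
    and R_near_1: "\<bar>R N - 1\<bar> \<le> 1 / (l N)\<^sup>2 + 2 * sqrt (2 * pi) * (l N * d N)" for N
    unfolding R_def B_def l_def d_def
    by (rule tiltable.prob_ge_ratio[OF til hpos[of N] vpos[of N]])+
  have d_nonneg: "0 \<le> d N" for N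
    unfolding d_def
    by (intro kolmogorov_dist_nonneg real_dist_normal_dist
        tiltable.real_distribution_standardized[OF til] less_imp_le hpos)
  have ld: "\<forall>\<^sub>F N in sequentially. l N * d N \<le> C * (\<epsilon> N * l N)"
    using C(2)
  proof eventually_elim
    case (elim N)
    then have "d N \<le> C * \<epsilon> N" using \<epsilon> by (simp add: pos_divide_le_eq)
    then show ?case using lpos[of N] by (simp add: mult.commute mult_left_mono mult.left_commute)
  qed
  {
    assume "\<epsilon> \<lless> (\<lambda>N. 1 / (h N * sqrt (v N))) \<and> (\<lambda>N. 1 / (h N * sqrt (v N))) \<lless> (\<lambda>N. 1)"
    then have \<epsilon>l: "(\<lambda>N. \<epsilon> N * l N) \<longlonglongrightarrow> 0" and inv: "(\<lambda>N. 1 / l N) \<longlonglongrightarrow> 0"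
      by (auto simp: seq_negligible_def l_def)
    have "(\<lambda>N. l N * d N) \<longlonglongrightarrow> 0"
    proof (rule tendsto_sandwich[OF _ ld])
      show "\<forall>\<^sub>F N in sequentially. 0 \<le> l N * d N"
        using lpos d_nonneg by (simp add: less_imp_le)
      show "(\<lambda>N. C * (\<epsilon> N * l N)) \<longlonglongrightarrow> 0"
        using tendsto_mult_left[OF \<epsilon>l, of C] by simp
    qed simp
    then have "(\<lambda>N. (1 / l N)\<^sup>2 + 2 * sqrt (2 * pi) * (l N * d N)) \<longlonglongrightarrow> 0\<^sup>2 + 2 * sqrt (2 * pi) * 0"
      by (intro tendsto_intros inv)
    then have "(\<lambda>N. 1 / (l N)\<^sup>2 + 2 * sqrt (2 * pi) * (l N * d N)) \<longlonglongrightarrow> 0"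
      by (simp add: power_divide)
    then have "(\<lambda>N. R N - 1) \<longlonglongrightarrow> 0"
      by (rule Lim_null_comparison[rotated]) (simp add: R_near_1)
    moreover have "\<P>(\<omega> in P N. X N \<omega> \<ge> a N) = B N * (1 + (R N - 1))" for N
      using Bpos[of N] by (simp add: R_def)
    ultimately show "\<exists>\<delta> :: nat \<Rightarrow> real. \<delta> \<longlonglongrightarrow> 0 \<and>
          (\<forall>N. \<P>(\<omega> in P N. X N \<omega> \<ge> a N) =
            (LINT \<omega>|P N. exp (h N * (X N \<omega> - a N))) / (h N * sqrt (2 * pi * v N)) * (1 + \<delta> N))"
      unfolding B_def by blast
  next
    assume "\<epsilon> \<lessapprox> (\<lambda>N. 1 / (h N * sqrt (v N))) \<and> (\<lambda>N. 1 / (h N * sqrt (v N))) \<lless> (\<lambda>N. 1)"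
    then obtain D where D: "\<forall>\<^sub>F N in sequentially. \<epsilon> N / (1 / (h N * sqrt (v N))) \<le> D"
      using seq_dominated_imp_eventually_le by blast
    from D ld have "\<forall>\<^sub>F N in sequentially. R N \<le> 1 + 2 * sqrt (2 * pi) * (C * D)"
    proof eventually_elim
      case (elim N)
      then have "\<epsilon> N * l N \<le> D" by (simp add: l_def)
      then have "l N * d N \<le> C * D"
        using elim(2) C(1) by (meson mult_left_mono order_trans)
      then have "2 * sqrt (2 * pi) * (l N * d N) \<le> 2 * sqrt (2 * pi) * (C * D)"
        by (intro mult_left_mono) auto
      then show ?case using R_le[of N] by linarith
    qed
    then show "(\<lambda>N. \<P>(\<omega> in P N. X N \<omega> \<ge> a N)) \<lessapprox>
        (\<lambda>N. (LINT \<omega>|P N. exp (h N * (X N \<omega> - a N))) / (h N * sqrt (2 * pi * v N)))"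
      unfolding R_def B_def by (rule eventually_le_imp_seq_dominated)
  }
qed

end
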